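(* Let $n\ge 2$, $m\ge1$, $1\le s\le n-1$, $r\in\mathbb{Z}/n\mathbb{Z}$, and let $D$ be a cylindric skew shape in $\mathcal{Q}_s=\mathbb{Z}^2/(n-s,s)\mathbb{Z}$. Then the cylindric loop Schur function $s^{(r)}_D(\mathtt{x}_1,\mathtt{x}_2,\dots,\mathtt{x}_m)$ lies in the ring $\mathrm{LSym}_m$ of loop symmetric polynomials.
   Context: Variables are $\mathtt{x}_j^{(i)}$ with $1\le j\le m$ and $i\in\mathbb{Z}/n\mathbb{Z}$ (upper indices are always taken modulo $n$); $\mathtt{x}_j=(\mathtt{x}_j^{(1)},\dots,\mathtt{x}_j^{(n)})$. **Loop symmetric polynomials.** For $r\in\mathbb{Z}/n\mathbb{Z}$, the elementary loop symmetric functions are $$e_k^{(r)}(\mathtt{x}_1,\dots,\mathtt{x}_m)=\sum_{1\le i_1<i_2<\cdots<i_k\le m}\mathtt{x}_{i_1}^{(r)}\mathtt{x}_{i_2}^{(r+1)}\cdots\mathtt{x}_{i_k}^{(r+k-1)},$$ with $e_0^{(r)}=1$ and $e_k^{(r)}=0$ for $k<0$. $\mathrm{LSym}_m$ is the subring of $\mathbb{Z}[\mathtt{x}_j^{(i)}\mid 1\le j\le m,\ i\in\mathbb{Z}/n\mathbb{Z}]$ generated by all the $e_k^{(r)}$. **Cylindric skew shapes.** $\mathcal{Q}_s=\mathbb{Z}^2/(n-s,s)\mathbb{Z}$ is the quotient of $\mathbb{Z}^2$ by the shift $(a,b)\mapsto(a+n-s,b+s)$. It carries the partial order that is the transitive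 closure of the relations $(a,b)<(a+1,b)$ and $(a,b)<(a,b-1)$. (The box in row $i$, counted from the top, and column $j$ of a Young diagram has coordinates $(j,-i)$.) A cylindric skew shape is a finite convex subposet $D$ of $\mathcal{Q}_s$. The content of $(a,b)$ is $c(a,b)=-a-b$; it is well defined modulo $n$ on $\mathcal{Q}_s$. **Cylindric loop Schur functions.** A semistandard Young tableau of shape $D$ is a map $T:D\to\{1,\dots,m\}$ with $T(a,b)\le T(a+1,b)$ and $T(a,b)<T(a,b-1)$ whenever the corresponding boxes lie in $D$. Then $$s_D^{(r)}(\mathtt{x}_1,\dots,\mathtt{x}_m)=\sum_T\prod_{d\in D}\mathtt{x}_{T(d)}^{(c(d)+r)},$$ the sum over all semistandard Young tableaux $T$ of shape $D$; $s_D^{(r)}=1$ if $D=\emptyset$. *)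

theory Defs
  imports Main "HOL-Library.FuncSet" "HOL-Library.Poly_Mapping"
begin

section \<open>Loop symmetric polynomials\<close>

text \<open>
  Integer polynomials are finitely supported maps from exponent vectors to coefficients.
  The variable with lower index \<open>j\<close> and upper index \<open>i\<close> is indexed by the pair
  \<open>(j, i mod n)\<close>. Upper indices, i.e. elements of \<open>\<int>/n\<int>\<close>, are passed around as
  integers and only reduced modulo \<open>n\<close> inside \<open>loop_var\<close>. The type has variables with
  arbitrary lower index; those used below have lower index in \<open>{1..m}\<close>.
\<close>

type_synonym loop_poly = "((nat \<times> int) \<Rightarrow>\<^sub>0 nat) \<Rightarrow>\<^sub>0 int"

definition loop_var :: "nat \<Rightarrow> nat \<Rightarrow> int \<Rightarrow> loop_poly" where
  "loop_var n j i = Poly_Mapping.single (Poly_Mapping.single (j, i mod int n) 1) 1"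

lemma loop_var_cong: "i mod int n = i' mod int n \<Longrightarrow> loop_var n j i = loop_var n j i'"
  by (simp add: loop_var_def)

definition strict_seqs :: "nat \<Rightarrow> int \<Rightarrow> nat list set" where
  "strict_seqs m k = {js. sorted_wrt (<) js \<and> set js \<subseteq> {1..m} \<and> int (length js) = k}"

text \<open>List positions start at 0, so position \<open>t\<close> carries the upper index \<open>r + t\<close>.
  For \<open>k < 0\<close> the sum is empty.\<close>

definition loop_e :: "nat \<Rightarrow> nat \<Rightarrow> int \<Rightarrow> int \<Rightarrow> loop_poly" where
  "loop_e n m k r =
     (\<Sum>js\<in>strict_seqs m k. \<Prod>t<length js. loop_var n (js ! t) (r + int t))"

lemma finite_strict_seqs: "finite (strict_seqs m k)"
proof (rule finite_subset)
  show "strict_seqs m k \<subseteq> {js. set js \<subseteq> {1..m} \<and> length js = nat k}"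
    by (auto simp: strict_seqs_def)
qed (simp add: finite_lists_length_eq)

lemma loop_e_0: "loop_e n m 0 r = 1"
proof -
  have "strict_seqs m 0 = {[]}" by (auto simp: strict_seqs_def)
  then show ?thesis by (simp add: loop_e_def)
qed

lemma loop_e_neg: "k < 0 \<Longrightarrow> loop_e n m k r = 0"
proof -
  assume "k < 0"
  then have "strict_seqs m k = {}" by (auto simp: strict_seqs_def)
  then show ?thesis by (simp add: loop_e_def)
qed

inductive_set subring_generated :: "'a::ring_1 set \<Rightarrow> 'a set" for S :: "'a set" where
  incl: "x \<in> S \<Longrightarrow> x \<in> subring_generated S"
| one: "1 \<in> subring_generated S"
| diff: "x \<in> subring_generated S \<Longrightarrow> y \<in> subring_generated S \<Longrightarrow> x - y \<in> subring_generated S"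
| mult: "x \<in> subring_generated S \<Longrightarrow> y \<in> subring_generated S \<Longrightarrow> x * y \<in> subring_generated S"

definition LSym :: "nat \<Rightarrow> nat \<Rightarrow> loop_poly set" where
  "LSym n m = subring_generated {loop_e n m k r | k r. True}"


section \<open>Cylindric skew shapes\<close>

definition cyl_rel :: "nat \<Rightarrow> nat \<Rightarrow> ((int \<times> int) \<times> (int \<times> int)) set" where
  "cyl_rel n s =
     {((a, b), (a', b')). \<exists>k. a' = a + k * (int n - int s) \<and> b' = b + k * int s}"

definition cyl :: "nat \<Rightarrow> nat \<Rightarrow> (int \<times> int) set set" where
  "cyl n s = UNIV // cyl_rel n s"

definition cyl_box :: "nat \<Rightarrow> nat \<Rightarrow> int \<Rightarrow> int \<Rightarrow> (int \<times> int) set" where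
  "cyl_box n s a b = cyl_rel n s `` {(a, b)}"

definition cyl_less :: "nat \<Rightarrow> nat \<Rightarrow> ((int \<times> int) set \<times> (int \<times> int) set) set" where
  "cyl_less n s =
     ({(cyl_box n s a b, cyl_box n s (a + 1) b) | a b. True} \<union>
      {(cyl_box n s a b, cyl_box n s a (b - 1)) | a b. True})\<^sup>+"

definition cyl_shape :: "nat \<Rightarrow> nat \<Rightarrow> (int \<times> int) set set \<Rightarrow> bool" where
  "cyl_shape n s D \<longleftrightarrow> D \<subseteq> cyl n s \<and> finite D \<and>
     (\<forall>x\<in>D. \<forall>z\<in>D. \<forall>y\<in>cyl n s. (x, y) \<in> cyl_less n s \<and> (y, z) \<in> cyl_less n s \<longrightarrow> y \<in> D)"

text \<open>The content of a box, as a representative in \<open>{0..<n}\<close>; the image is a singleton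
  for every box of the cylinder, see \<open>cyl_content_box\<close> below.\<close>

definition cyl_content :: "nat \<Rightarrow> (int \<times> int) set \<Rightarrow> int" where
  "cyl_content n d = the_elem ((\<lambda>(a, b). (- a - b) mod int n) ` d)"

lemma equiv_cyl_rel: "equiv UNIV (cyl_rel n s)"
proof (rule equivI)
  show "cyl_rel n s \<subseteq> UNIV \<times> UNIV" by simp
  show "refl (cyl_rel n s)"
    by (auto simp: refl_on_def cyl_rel_def intro: exI[of _ 0])
  show "sym (cyl_rel n s)"
  proof (rule symI, clarify)
    fix a b a' b' assume "((a, b), (a', b')) \<in> cyl_rel n s"
    then obtain k where "a' = a + k * (int n - int s)" "b' = b + k * int s"
      by (auto simp: cyl_rel_def)
    then show "((a', b'), (a, b)) \<in> cyl_rel n s"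
      unfolding cyl_rel_def by (auto intro!: exI[of _ "- k"] simp: algebra_simps)
  qed
  show "trans (cyl_rel n s)"
  proof (rule transI, clarify)
    fix a b a' b' a'' b''
    assume "((a, b), (a', b')) \<in> cyl_rel n s" "((a', b'), (a'', b'')) \<in> cyl_rel n s"
    then obtain k l where "a' = a + k * (int n - int s)" "b' = b + k * int s"
      "a'' = a' + l * (int n - int s)" "b'' = b' + l * int s"
      by (auto simp: cyl_rel_def)
    then show "((a, b), (a'', b'')) \<in> cyl_rel n s"
      unfolding cyl_rel_def by (auto intro!: exI[of _ "k + l"] simp: algebra_simps)
  qed
qed

lemma cyl_box_self: "(a, b) \<in> cyl_box n s a b"
  using equiv_cyl_rel[of n s] by (simp add: cyl_box_def equiv_def refl_on_def)

lemma cyl_content_box: "cyl_content n (cyl_box n s a b) = (- a - b) mod int n"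
proof -
  define f where "f = (\<lambda>(a, b). (- a - b) mod int n)"
  have f: "f p = f (a, b)" if mem: "p \<in> cyl_box n s a b" for p
  proof -
    obtain k where p: "p = (a + k * (int n - int s), b + k * int s)"
      using mem unfolding cyl_box_def cyl_rel_def by blast
    have "- (a + k * (int n - int s)) - (b + k * int s) = (- a - b) + (- k) * int n"
      by (simp add: algebra_simps)
    then show ?thesis unfolding p f_def prod.case by (simp only: mod_mult_self1)
  qed
  have "f ` cyl_box n s a b = {f (a, b)}"
    using cyl_box_self f by blast
  then show ?thesis by (simp add: cyl_content_def f_def)
qed

lemma cyl_less_irrefl:
  assumes "1 \<le> s" "s < n"
  shows "(x, x) \<notin> cyl_less n s"
proof -
  define f where "f = (\<lambda>(a, b). int s * a - (int n - int s) * b)"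
  define h where "h = (\<lambda>d. the_elem (f ` d))"
  have h: "h (cyl_box n s a b) = int s * a - (int n - int s) * b" for a b
  proof -
    have f: "f p = f (a, b)" if mem: "p \<in> cyl_box n s a b" for p
    proof -
      obtain k where "p = (a + k * (int n - int s), b + k * int s)"
        using mem unfolding cyl_box_def cyl_rel_def by blast
      then show ?thesis by (simp add: f_def algebra_simps)
    qed
    have "f ` cyl_box n s a b = {f (a, b)}"
      using cyl_box_self f by blast
    then show ?thesis by (simp add: h_def f_def)
  qed
  have cover: "h y < h z"
    if yz: "(y, z) \<in> {(cyl_box n s a b, cyl_box n s (a + 1) b) | a b. True} \<union>
      {(cyl_box n s a b, cyl_box n s a (b - 1)) | a b. True}" for y z
  proof -
    obtain a b where "y = cyl_box n s a b"
      "z = cyl_box n s (a + 1) b \<or> z = cyl_box n s a (b - 1)"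
      using yz by blast
    then show ?thesis
      using assms by (elim disjE) (simp_all add: h right_diff_distrib distrib_left)
  qed
  have "h x < h y" if "(x, y) \<in> cyl_less n s" for x y
    using that unfolding cyl_less_def
  proof (induction rule: trancl_induct)
    case (base y)
    then show ?case by (rule cover)
  next
    case (step y z)
    from step.IH cover[OF step.hyps(2)] show ?case by (rule less_trans)
  qed
  then show ?thesis by blast
qed


section \<open>Cylindric loop Schur functions\<close>

text \<open>Tableaux are extensional functions, so that each filling of \<open>D\<close> is counted once.\<close>

definition cyl_ssyt ::
  "nat \<Rightarrow> nat \<Rightarrow> nat \<Rightarrow> (int \<times> int) set set \<Rightarrow> ((int \<times> int) set \<Rightarrow> nat) set" where
  "cyl_ssyt n s m D = {T \<in> D \<rightarrow>\<^sub>E {1..m}.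
     (\<forall>a b. cyl_box n s a b \<in> D \<and> cyl_box n s (a + 1) b \<in> D \<longrightarrow>
        T (cyl_box n s a b) \<le> T (cyl_box n s (a + 1) b)) \<and>
     (\<forall>a b. cyl_box n s a b \<in> D \<and> cyl_box n s a (b - 1) \<in> D \<longrightarrow>
        T (cyl_box n s a b) < T (cyl_box n s a (b - 1)))}"

lemma finite_cyl_ssyt: "finite D \<Longrightarrow> finite (cyl_ssyt n s m D)"
  by (rule finite_subset[of _ "D \<rightarrow>\<^sub>E {1..m}"]) (auto simp: cyl_ssyt_def finite_PiE)

definition cyl_loop_schur ::
  "nat \<Rightarrow> nat \<Rightarrow> nat \<Rightarrow> int \<Rightarrow> (int \<times> int) set set \<Rightarrow> loop_poly" where
  "cyl_loop_schur n s m r D =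
     (\<Sum>T\<in>cyl_ssyt n s m D. \<Prod>d\<in>D. loop_var n (T d) (cyl_content n d + r))"

lemma cyl_loop_schur_empty: "cyl_loop_schur n s m r {} = 1"
proof -
  have "cyl_ssyt n s m {} = {\<lambda>_. undefined}" by (auto simp: cyl_ssyt_def)
  then show ?thesis by (simp add: cyl_loop_schur_def)
qed

end

theory Submission
  imports Defs "HOL-Combinatorics.Permutations"
begin

text \<open>
  Record a cylindric skew shape by its two boundaries: integer sequences \<open>p \<le> q\<close>, indexed by the
  columns, with \<open>p a\<close> the content of the top box of column \<open>a\<close> and \<open>q a - 1\<close> the content of its
  bottom box. Both are strictly decreasing and drop by \<open>n\<close> over \<open>N = n - s\<close> columns. The
  cylindric loop Schur function is then given by a Jacobi-Trudi formula of Gessel-Krattenthaler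
  type: it is the coefficient of \<open>t\<^sup>0\<close> in the determinant over \<open>0 \<le> a, b < N\<close> of the Laurent
  polynomials \<open>\<Sum>d. t^d e_{q b + n d - p a}^{(p a + r)}\<close>, whose coefficients lie in \<open>LSym\<close>.

  The formula follows by induction on the number of variables. Splitting off the last variable from
  every \<open>e\<close> writes the determinant as a sum over all ways of lowering some of the \<open>q b\<close> by 1.
  If the result is not strictly decreasing, two of its entries agree modulo \<open>n\<close>, so that two
  columns of the matrix are proportional by a power of \<open>t\<close> and the determinant vanishes; the other
  terms correspond to the possible positions of the largest entry in a semistandard tableau.
\<close>

section \<open>Finitely supported maps as Laurent polynomials\<close>

lemma lookup_single_mult:
  fixes f :: "'a::ab_group_add \<Rightarrow>\<^sub>0 'b::comm_ring_1"
  shows "Poly_Mapping.lookup (Poly_Mapping.single k c * f) d = c * Poly_Mapping.lookup f (d - k)"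
proof -
  have *: "(\<Sum>q. Poly_Mapping.lookup f q when d = l + q) = Poly_Mapping.lookup f (d - l)" for l
  proof -
    have "(Poly_Mapping.lookup f q when d = l + q) = (Poly_Mapping.lookup f q when q = d - l)" for q
      by (auto simp: when_def algebra_simps)
    then show ?thesis by simp
  qed
  have "Poly_Mapping.lookup (Poly_Mapping.single k c * f) d =
      (\<Sum>l. (c * Poly_Mapping.lookup f (d - l)) when l = k)"
    unfolding lookup_mult * lookup_single by (intro Sum_any.cong) (simp add: when_def)
  then show ?thesis by simp
qed

text \<open>The integers have no 2-torsion. Coefficients are taken twice because the coefficients of
  \<open>x\<close> are themselves integer polynomials.\<close>

lemma eq_neg_self_poly_mapping:
  fixes x :: "'a \<Rightarrow>\<^sub>0 loop_poly"
  assumes "x = - x"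
  shows "x = 0"
proof (rule poly_mapping_eqI, rule poly_mapping_eqI)
  fix k l
  have "Poly_Mapping.lookup (Poly_Mapping.lookup x k) l = - Poly_Mapping.lookup (Poly_Mapping.lookup x k) l"
    using arg_cong[OF assms, of "\<lambda>x. Poly_Mapping.lookup (Poly_Mapping.lookup x k) l"] by simp
  then show "Poly_Mapping.lookup (Poly_Mapping.lookup x k) l = Poly_Mapping.lookup (Poly_Mapping.lookup 0 k) l" by simp
qed

lemma poly_mapping_eq_sum_single:
  "f = (\<Sum>k\<in>Poly_Mapping.keys f. Poly_Mapping.single k (Poly_Mapping.lookup f k))"
proof (rule poly_mapping_eqI)
  fix k
  have "(\<Sum>l\<in>Poly_Mapping.keys f. Poly_Mapping.lookup (Poly_Mapping.single l (Poly_Mapping.lookup f l)) k) =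
      (\<Sum>l\<in>Poly_Mapping.keys f. if k = l then Poly_Mapping.lookup f l else 0)"
    by (intro sum.cong) (auto simp: lookup_single when_def)
  then show "Poly_Mapping.lookup f k =
      Poly_Mapping.lookup (\<Sum>k\<in>Poly_Mapping.keys f. Poly_Mapping.single k (Poly_Mapping.lookup f k)) k"
    by (simp add: lookup_sum in_keys_iff)
qed

section \<open>Subrings\<close>

lemma subring_generated_zero: "0 \<in> subring_generated S"
  using subring_generated.diff[OF subring_generated.one subring_generated.one, of S] by simp

lemma subring_generated_uminus: "x \<in> subring_generated S \<Longrightarrow> - x \<in> subring_generated S"
  using subring_generated.diff[OF subring_generated_zero] by fastforce

lemma subring_generated_add:
  "x \<in> subring_generated S \<Longrightarrow> y \<in> subring_generated S \<Longrightarrow> x + y \<in> subring_generated S"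
  using subring_generated.diff[OF _ subring_generated_uminus, of x S y] by simp

lemma subring_generated_sum:
  "(\<And>i. i \<in> A \<Longrightarrow> f i \<in> subring_generated S) \<Longrightarrow> sum f A \<in> subring_generated S"
  by (induction A rule: infinite_finite_induct)
    (auto simp: subring_generated_zero subring_generated_add)

text \<open>A coefficient of a product is a finite sum of products of coefficients, so Laurent
  polynomials with coefficients in a subring are closed under multiplication.\<close>

lemma lookup_mult_in_subring_generated:
  fixes f g :: "int \<Rightarrow>\<^sub>0 'b::comm_ring_1"
  assumes "\<And>d. Poly_Mapping.lookup f d \<in> subring_generated S" "\<And>d. Poly_Mapping.lookup g d \<in> subring_generated S"
  shows "Poly_Mapping.lookup (f * g) d \<in> subring_generated S"
proof -
  have "f * g = (\<Sum>k\<in>Poly_Mapping.keys f. Poly_Mapping.single k (Poly_Mapping.lookup f k) * g)"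
    by (subst poly_mapping_eq_sum_single[of f]) (simp only: sum_distrib_right)
  then have "Poly_Mapping.lookup (f * g) d = (\<Sum>k\<in>Poly_Mapping.keys f. Poly_Mapping.lookup f k * Poly_Mapping.lookup g (d - k))"
    by (simp add: lookup_sum lookup_single_mult)
  then show ?thesis
    by (auto intro!: subring_generated_sum subring_generated.mult assms)
qed

lemma lookup_prod_in_subring_generated:
  fixes f :: "'i \<Rightarrow> int \<Rightarrow>\<^sub>0 'b::comm_ring_1"
  assumes "\<And>i d. i \<in> A \<Longrightarrow> Poly_Mapping.lookup (f i) d \<in> subring_generated S"
  shows "Poly_Mapping.lookup (prod f A) d \<in> subring_generated S"
  using assms
  by (induction A arbitrary: d rule: infinite_finite_induct)
    (auto intro!: lookup_mult_in_subring_generated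
      simp: lookup_one when_def subring_generated.one subring_generated_zero)

section \<open>The recursion for elementary loop symmetric functions\<close>

text \<open>A strictly increasing sequence bounded by \<open>Suc m\<close> can contain
  \<open>Suc m\<close> only as its last entry.\<close>

lemma strict_seqs_Suc:
  "strict_seqs (Suc m) k = strict_seqs m k \<union> (\<lambda>js. js @ [Suc m]) ` strict_seqs m (k - 1)"
proof (intro equalityI subsetI)
  fix js assume js: "js \<in> strict_seqs (Suc m) k"
  show "js \<in> strict_seqs m k \<union> (\<lambda>js. js @ [Suc m]) ` strict_seqs m (k - 1)"
  proof (cases js rule: rev_cases)
    case Nil
    then show ?thesis using js by (auto simp: strict_seqs_def)
  next
    case (snoc ys y)
    show ?thesis
    proof (cases "y = Suc m")
      case True
      have "ys \<in> strict_seqs m (k - 1)"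
        using js unfolding snoc True by (fastforce simp: strict_seqs_def sorted_wrt_append)
      then show ?thesis using snoc True by blast
    next
      case False
      have "js \<in> strict_seqs m k"
        using js False unfolding snoc by (fastforce simp: strict_seqs_def sorted_wrt_append)
      then show ?thesis by blast
    qed
  qed
next
  fix js assume "js \<in> strict_seqs m k \<union> (\<lambda>js. js @ [Suc m]) ` strict_seqs m (k - 1)"
  then show "js \<in> strict_seqs (Suc m) k"
    by (fastforce simp: strict_seqs_def sorted_wrt_append)
qed

lemma loop_e_Suc:
  "loop_e n (Suc m) k r = loop_e n m k r + loop_var n (Suc m) (r + k - 1) * loop_e n m (k - 1) r"
proof -
  let ?w = "\<lambda>js. \<Prod>t<length js. loop_var n (js ! t) (r + int t)"
  have disj: "strict_seqs m k \<inter> (\<lambda>js. js @ [Suc m]) ` strict_seqs m (k - 1) = {}"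
  proof -
    have "Suc m \<notin> set js" if "js \<in> strict_seqs m k" for js
      using that by (auto simp: strict_seqs_def)
    then show ?thesis by fastforce
  qed
  have inj: "inj_on (\<lambda>js. js @ [Suc m]) (strict_seqs m (k - 1))"
    by (simp add: inj_on_def)
  have "?w (js @ [Suc m]) = loop_var n (Suc m) (r + k - 1) * ?w js"
    if "js \<in> strict_seqs m (k - 1)" for js
  proof -
    \<comment> \<open>The appended entry sits at position \<open>length js = k - 1\<close>, counted
      from 0, which fixes its upper index.\<close>
    have k: "r + int (length js) = r + k - 1" using that by (auto simp: strict_seqs_def)
    have "?w (js @ [Suc m]) =
        (\<Prod>t<length js. loop_var n ((js @ [Suc m]) ! t) (r + int t)) * loop_var n (Suc m) (r + k - 1)"
      by (simp only: length_append_singleton prod.lessThan_Suc nth_append_length k)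
    also have "(\<Prod>t<length js. loop_var n ((js @ [Suc m]) ! t) (r + int t)) = ?w js"
      by (intro prod.cong refl) (simp add: nth_append)
    finally show ?thesis by (rule trans) (rule mult.commute)
  qed
  then have w: "sum ?w ((\<lambda>js. js @ [Suc m]) ` strict_seqs m (k - 1)) =
      loop_var n (Suc m) (r + k - 1) * sum ?w (strict_seqs m (k - 1))"
    unfolding sum.reindex[OF inj] o_def sum_distrib_left by (rule sum.cong[OF refl])
  have "loop_e n (Suc m) k r =
      sum ?w (strict_seqs m k) + sum ?w ((\<lambda>js. js @ [Suc m]) ` strict_seqs m (k - 1))"
    unfolding loop_e_def strict_seqs_Suc
    by (intro sum.union_disjoint disj finite_imageI finite_strict_seqs)
  also have "\<dots> = loop_e n m k r + loop_var n (Suc m) (r + k - 1) * loop_e n m (k - 1) r"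
    unfolding w loop_e_def ..
  finally show ?thesis .
qed

lemma loop_e_0_vars: "loop_e n 0 k r = (if k = 0 then 1 else 0)"
proof -
  have "strict_seqs 0 k = (if k = 0 then {[]} else {})" by (auto simp: strict_seqs_def)
  then show ?thesis by (simp add: loop_e_def)
qed

text \<open>No strictly increasing sequence in \<open>{1..m}\<close> is longer than
  \<open>m\<close>. Together with \<open>loop_e_neg\<close> this is what makes the matrix entries
  below finitely supported.\<close>

lemma loop_e_large: "k > int m \<Longrightarrow> loop_e n m k r = 0"
  by (induction m arbitrary: k) (simp_all add: loop_e_0_vars loop_e_Suc)

lemma loop_e_in_LSym: "loop_e n m k r \<in> LSym n m"
  unfolding LSym_def by (rule subring_generated.incl) blast

section \<open>Alternating sums\<close>

text \<open>The determinant of a matrix with rows and columns indexed by \<open>I\<close>;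
  \<open>b\<close> is the column and \<open>\<pi> b\<close> the row.\<close>

definition leibniz_sum :: "int set \<Rightarrow> (int \<Rightarrow> int \<Rightarrow> 'a::comm_ring_1) \<Rightarrow> 'a" where
  "leibniz_sum I M = (\<Sum>\<pi> | \<pi> permutes I. of_int (sign \<pi>) * (\<Prod>b\<in>I. M (\<pi> b) b))"

text \<open>Column \<open>i\<close> is \<open>z\<close> times column \<open>j\<close>. Composing
  \<open>\<pi>\<close> with the transposition of \<open>i\<close> and \<open>j\<close> keeps the
  product of entries and flips the sign, so the sum equals its own negative.\<close>

lemma leibniz_sum_eq_0:
  fixes M :: "int \<Rightarrow> int \<Rightarrow> 'a::comm_monoid_add \<Rightarrow>\<^sub>0 loop_poly" and z :: "'a \<Rightarrow>\<^sub>0 loop_poly"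
  assumes I: "finite I" "i \<in> I" "j \<in> I" "i \<noteq> j" and M: "\<And>a. M a i = z * M a j"
  shows "leibniz_sum I M = 0"
proof -
  let ?t = "transpose i j"
  let ?term = "\<lambda>\<pi>. of_int (sign \<pi>) * (\<Prod>b\<in>I. M (\<pi> b) b)"
  have t: "?t permutes I" using I by (simp add: permutes_swap_id)
  have split: "(\<Prod>b\<in>I. g b) = g i * g j * (\<Prod>b\<in>I - {i, j}. g b)"
    for g :: "int \<Rightarrow> 'a \<Rightarrow>\<^sub>0 loop_poly"
  proof -
    have "(\<Prod>b\<in>I. g b) = g i * (\<Prod>b\<in>I - {i}. g b)"
      using I by (intro prod.remove)
    also have "(\<Prod>b\<in>I - {i}. g b) = g j * (\<Prod>b\<in>I - {i} - {j}. g b)"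
      using I by (intro prod.remove) auto
    also have "I - {i} - {j} = I - {i, j}" by auto
    finally show ?thesis by (simp only: mult.assoc)
  qed
  have "?term (\<pi> \<circ> ?t) = - ?term \<pi>" if \<pi>: "\<pi> permutes I" for \<pi>
  proof -
    have "(\<Prod>b\<in>I - {i, j}. M ((\<pi> \<circ> ?t) b) b) = (\<Prod>b\<in>I - {i, j}. M (\<pi> b) b)"
      by (intro prod.cong) auto
    then have "(\<Prod>b\<in>I. M ((\<pi> \<circ> ?t) b) b) = (\<Prod>b\<in>I. M (\<pi> b) b)"
      unfolding split[of "\<lambda>b. M ((\<pi> \<circ> ?t) b) b"] split[of "\<lambda>b. M (\<pi> b) b"]
      by (simp add: M ac_simps)
    moreover have "sign (\<pi> \<circ> ?t) = - sign \<pi>"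
      using sign_compose[OF permutation_permutes[THEN iffD2] permutation_permutes[THEN iffD2], of \<pi> ?t]
        \<pi> t I by (auto simp: sign_swap_id)
    ultimately show ?thesis by simp
  qed
  then have "leibniz_sum I M = - leibniz_sum I M"
    unfolding leibniz_sum_def
    by (subst sum_permutations_compose_right[OF t]) (simp add: sum_negf)
  then show ?thesis by (rule eq_neg_self_poly_mapping)
qed

section \<open>The cylindric Jacobi-Trudi sum\<close>

text \<open>The exponent \<open>d\<close> of the Laurent variable t counts periods by which
  \<open>y\<close> is moved. \<open>Abs_poly_mapping\<close> is meaningful only for finite support,
  which the next lemma establishes for positive \<open>n\<close>.\<close>

definition loop_entry :: "nat \<Rightarrow> nat \<Rightarrow> int \<Rightarrow> int \<Rightarrow> int \<Rightarrow> int \<Rightarrow>\<^sub>0 loop_poly" where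
  "loop_entry n m r x y = Abs_poly_mapping (\<lambda>d. loop_e n m (y + int n * d - x) (x + r))"

text \<open>A nonzero coefficient needs a degree between 0 and \<open>m\<close>, and this confines
  \<open>d\<close> to a bounded interval because \<open>n\<close> is at least 1.\<close>

lemma lookup_loop_entry:
  assumes "0 < n"
  shows "Poly_Mapping.lookup (loop_entry n m r x y) d = loop_e n m (y + int n * d - x) (x + r)"
proof -
  have "{d. loop_e n m (y + int n * d - x) (x + r) \<noteq> 0} \<subseteq> {- \<bar>x - y\<bar>..\<bar>x - y\<bar> + int m}"
  proof
    fix d assume "d \<in> {d. loop_e n m (y + int n * d - x) (x + r) \<noteq> 0}"
    then have d: "0 \<le> y + int n * d - x" "y + int n * d - x \<le> int m"
      using loop_e_neg loop_e_large by (force simp: not_less)+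
    have n: "1 \<le> int n" using assms by simp
    have "d \<ge> - \<bar>x - y\<bar>"
    proof (cases "d \<le> 0")
      case True
      then have "int n * d \<le> 1 * d" using n by (intro mult_right_mono_neg)
      then show ?thesis using d by linarith
    qed auto
    moreover have "d \<le> \<bar>x - y\<bar> + int m"
    proof (cases "0 \<le> d")
      case True
      then have "1 * d \<le> int n * d" using n by (intro mult_right_mono)
      then show ?thesis using d by linarith
    qed auto
    ultimately show "d \<in> {- \<bar>x - y\<bar>..\<bar>x - y\<bar> + int m}" by simp
  qed
  then have "finite {d. loop_e n m (y + int n * d - x) (x + r) \<noteq> 0}"
    by (rule finite_subset) simp
  then show ?thesis unfolding loop_entry_def by simp
qed

text \<open>Moving \<open>y\<close> by \<open>c\<close> periods reindexes the coefficients from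
  \<open>d\<close> to \<open>d + c\<close>, which is multiplication by the power \<open>- c\<close>
  of t.\<close>

lemma loop_entry_shift:
  assumes "0 < n"
  shows "loop_entry n m r x (y + int n * c) = Poly_Mapping.single (- c) 1 * loop_entry n m r x y"
  by (rule poly_mapping_eqI)
    (simp add: lookup_loop_entry[OF assms] lookup_single_mult algebra_simps)

text \<open>The upper index of the split-off variable is \<open>y - 1 + r\<close> modulo
  \<open>n\<close>, whatever \<open>x\<close> and \<open>d\<close> are. The new factor is therefore
  constant in t and the same along a whole matrix column.\<close>

lemma loop_entry_Suc:
  assumes "0 < n"
  shows "loop_entry n (Suc m) r x y = loop_entry n m r x y +
    Poly_Mapping.single 0 (loop_var n (Suc m) (y - 1 + r)) * loop_entry n m r x (y - 1)"
proof (rule poly_mapping_eqI)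
  fix d
  have "loop_var n (Suc m) (x + r + (y + int n * d - x) - 1) = loop_var n (Suc m) (y - 1 + r)"
  proof (rule loop_var_cong)
    have "x + r + (y + int n * d - x) - 1 = y - 1 + r + int n * d" by simp
    then show "(x + r + (y + int n * d - x) - 1) mod int n = (y - 1 + r) mod int n"
      by (simp only: mod_mult_self2)
  qed
  moreover have "y + int n * d - x - 1 = y - 1 + int n * d - x" by simp
  ultimately show "Poly_Mapping.lookup (loop_entry n (Suc m) r x y) d =
    Poly_Mapping.lookup (loop_entry n m r x y +
    Poly_Mapping.single 0 (loop_var n (Suc m) (y - 1 + r)) * loop_entry n m r x (y - 1)) d"
    by (simp only: lookup_loop_entry[OF assms] lookup_single_mult lookup_add loop_e_Suc diff_0_right)
qed

text \<open>Only degree 0 survives without variables, so \<open>d\<close> must solve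
  \<open>y + n * d = x\<close>.\<close>

lemma loop_entry_0_vars:
  assumes "0 < n"
  shows "loop_entry n 0 r x y =
    (if int n dvd x - y then Poly_Mapping.single ((x - y) div int n) 1 else 0)"
proof (rule poly_mapping_eqI)
  fix d
  have *: "y + int n * d - x = 0 \<longleftrightarrow> int n dvd x - y \<and> (x - y) div int n = d"
    using assms by (auto simp: algebra_simps)
  show "Poly_Mapping.lookup (loop_entry n 0 r x y) d =
    Poly_Mapping.lookup
      (if int n dvd x - y then Poly_Mapping.single ((x - y) div int n) 1 else 0) d"
    unfolding lookup_loop_entry[OF assms] loop_e_0_vars * by (simp add: lookup_single when_def)
qed

definition jacobi_trudi :: "nat \<Rightarrow> nat \<Rightarrow> int \<Rightarrow> int set \<Rightarrow> (int \<Rightarrow> int) \<Rightarrow> (int \<Rightarrow> int) \<Rightarrow> loop_poly" where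
  "jacobi_trudi n m r I p q =
     Poly_Mapping.lookup (leibniz_sum I (\<lambda>a b. loop_entry n m r (p a) (q b))) 0"

lemma jacobi_trudi_in_LSym:
  assumes "0 < n"
  shows "jacobi_trudi n m r I p q \<in> LSym n m"
proof -
  have e: "Poly_Mapping.lookup (loop_entry n m r x y) d \<in> LSym n m" for x y d
    unfolding lookup_loop_entry[OF assms] by (rule loop_e_in_LSym)
  have "Poly_Mapping.lookup (of_int (sign \<pi>) * (\<Prod>b\<in>I. loop_entry n m r (p (\<pi> b)) (q b))) 0
      \<in> LSym n m" for \<pi>
  proof -
    have "Poly_Mapping.lookup (\<Prod>b\<in>I. loop_entry n m r (p (\<pi> b)) (q b)) 0 \<in> LSym n m"
      using e unfolding LSym_def by (rule lookup_prod_in_subring_generated)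
    then show ?thesis
      by (cases \<pi> rule: sign_cases) (auto simp: LSym_def subring_generated_uminus)
  qed
  then show ?thesis
    unfolding jacobi_trudi_def leibniz_sum_def lookup_sum LSym_def
    by (intro subring_generated_sum)
qed

lemma jacobi_trudi_eq_0:
  assumes "0 < n" "finite I" "i \<in> I" "j \<in> I" "i \<noteq> j" "q i = q j + int n * c"
  shows "jacobi_trudi n m r I p q = 0"
proof -
  have "leibniz_sum I (\<lambda>a b. loop_entry n m r (p a) (q b)) = 0"
    using assms(2-5)
    by (rule leibniz_sum_eq_0) (simp only: assms(6) loop_entry_shift[OF assms(1)])
  then show ?thesis by (simp add: jacobi_trudi_def)
qed

lemma jacobi_trudi_cong:
  "(\<And>a. a \<in> I \<Longrightarrow> q a = q' a) \<Longrightarrow> jacobi_trudi n m r I p q = jacobi_trudi n m r I p q'"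
  unfolding jacobi_trudi_def leibniz_sum_def by (simp cong: prod.cong)

text \<open>Multilinearity in the columns: \<open>S\<close> is the set of columns in which the
  second summand of \<open>loop_entry_Suc\<close> is chosen. Its factors do not involve the row or
  t, so they come out of the determinant and of the coefficient extraction.\<close>

lemma jacobi_trudi_Suc:
  assumes n: "0 < n" and I: "finite I"
  shows "jacobi_trudi n (Suc m) r I p q =
    (\<Sum>S\<in>Pow I. (\<Prod>b\<in>S. loop_var n (Suc m) (q b - 1 + r)) *
      jacobi_trudi n m r I p (\<lambda>b. q b - of_bool (b \<in> S)))"
proof -
  let ?E = "\<lambda>m. loop_entry n m r"
  let ?u = "\<lambda>b. loop_var n (Suc m) (q b - 1 + r)"
  have single_prod: "(\<Prod>b\<in>S. Poly_Mapping.single 0 (?u b)) =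
      (Poly_Mapping.single 0 (\<Prod>b\<in>S. ?u b) :: int \<Rightarrow>\<^sub>0 loop_poly)" for S
    by (induction S rule: infinite_finite_induct) (simp_all add: mult_single)
  have expand: "(\<Prod>b\<in>I. ?E (Suc m) (p (\<pi> b)) (q b)) =
     (\<Sum>S\<in>Pow I. Poly_Mapping.single 0 (\<Prod>b\<in>S. ?u b) *
       (\<Prod>b\<in>I. ?E m (p (\<pi> b)) (q b - of_bool (b \<in> S))))" for \<pi>
  proof -
    have "(\<Prod>b\<in>I. ?E (Suc m) (p (\<pi> b)) (q b)) =
        (\<Prod>b\<in>I. Poly_Mapping.single 0 (?u b) * ?E m (p (\<pi> b)) (q b - 1) + ?E m (p (\<pi> b)) (q b))"
      unfolding loop_entry_Suc[OF n] by (simp only: add.commute)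
    also have "\<dots> = (\<Sum>S\<in>Pow I. (\<Prod>b\<in>S. Poly_Mapping.single 0 (?u b) * ?E m (p (\<pi> b)) (q b - 1)) *
        (\<Prod>b\<in>I - S. ?E m (p (\<pi> b)) (q b)))"
      by (rule prod_add[OF I])
    also have "\<dots> = (\<Sum>S\<in>Pow I. Poly_Mapping.single 0 (\<Prod>b\<in>S. ?u b) *
       (\<Prod>b\<in>I. ?E m (p (\<pi> b)) (q b - of_bool (b \<in> S))))"
    proof (rule sum.cong[OF refl])
      fix S assume "S \<in> Pow I"
      then have S: "S \<subseteq> I" by simp
      have "(\<Prod>b\<in>I. ?E m (p (\<pi> b)) (q b - of_bool (b \<in> S))) =
        (\<Prod>b\<in>S. ?E m (p (\<pi> b)) (q b - 1)) * (\<Prod>b\<in>I - S. ?E m (p (\<pi> b)) (q b))"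
        unfolding prod.subset_diff[OF S I] mult.commute[of "prod _ S"]
        by (intro arg_cong2[of _ _ _ _ "(*)"] prod.cong) auto
      then show "(\<Prod>b\<in>S. Poly_Mapping.single 0 (?u b) * ?E m (p (\<pi> b)) (q b - 1)) *
          (\<Prod>b\<in>I - S. ?E m (p (\<pi> b)) (q b)) =
          Poly_Mapping.single 0 (\<Prod>b\<in>S. ?u b) *
            (\<Prod>b\<in>I. ?E m (p (\<pi> b)) (q b - of_bool (b \<in> S)))"
        by (simp only: prod.distrib single_prod mult.assoc)
    qed
    finally show ?thesis .
  qed
  have "leibniz_sum I (\<lambda>a b. ?E (Suc m) (p a) (q b)) =
      (\<Sum>S\<in>Pow I. Poly_Mapping.single 0 (\<Prod>b\<in>S. ?u b) *
        leibniz_sum I (\<lambda>a b. ?E m (p a) (q b - of_bool (b \<in> S))))"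
    unfolding leibniz_sum_def expand sum_distrib_left
    by (subst sum.swap) (simp only: mult.left_commute)
  then show ?thesis
    unfolding jacobi_trudi_def by (simp only: lookup_sum lookup_single_mult diff_0_right)
qed

section \<open>Profiles\<close>

locale cylinder =
  fixes n s :: nat
  assumes s_pos: "1 \<le> s" and s_less: "s < n"
begin

text \<open>The number of columns in a fundamental domain of the cylinder.\<close>

definition width :: int where "width = int n - int s"

lemma width_pos: "0 < width"
  using s_less by (simp add: width_def)

lemma n_pos: "0 < n"
  using s_less by simp

text \<open>The box of content \<open>c\<close> in column \<open>a\<close> lies in row
  \<open>a + c\<close>. Strictly decreasing contents thus describe a boundary that weakly rises from
  left to right; the second condition makes it invariant under the shift by
  \<open>(n - s, s)\<close>.\<close>

definition profile :: "(int \<Rightarrow> int) \<Rightarrow> bool" where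
  "profile q \<longleftrightarrow> (\<forall>a. q (a + 1) < q a) \<and> (\<forall>a. q (a + width) = q a - int n)"

lemma profile_less: "profile q \<Longrightarrow> q (a + 1) < q a"
  by (simp add: profile_def)

lemma profile_shift:
  assumes "profile q"
  shows "q (a + k * width) = q a - k * int n"
proof (induction k arbitrary: a rule: int_induct[where k = 0])
  case (step1 i)
  have "q (a + (i + 1) * width) = q (a + i * width + width)"
    by (simp add: algebra_simps)
  also have "\<dots> = q (a + i * width) - int n"
    using assms by (simp add: profile_def)
  finally show ?case using step1 by (simp add: algebra_simps)
next
  case (step2 i)
  have "q (a + i * width) = q (a + (i - 1) * width + width)"
    by (simp add: algebra_simps)
  also have "\<dots> = q (a + (i - 1) * width) - int n"
    using assms by (simp add: profile_def)
  finally show ?case using step2 by (simp add: algebra_simps)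
qed simp

lemma profile_mod:
  assumes "profile q"
  shows "q a = q (a mod width) - (a div width) * int n"
  using profile_shift[OF assms, of "a mod width" "a div width"] unfolding mod_div_mult_eq .

lemma profile_strict:
  assumes q: "profile q" and "a < b"
  shows "q b < q a"
  using assms(2)
proof (induction rule: int_gr_induct)
  case base
  then show ?case using profile_less[OF q, of a] by simp
next
  case (step i)
  then show ?case using profile_less[OF q, of i] by simp
qed

lemma profile_less_iff: "profile q \<Longrightarrow> q b < q a \<longleftrightarrow> a < b"
  using profile_strict by (metis less_asym less_irrefl linorder_neqE)

lemma profile_eqI:
  assumes "profile p" "profile q" "\<And>a. a \<in> {0..<width} \<Longrightarrow> p a = q a"
  shows "p = q"
proof
  fix a
  have "p (a mod width) = q (a mod width)"
    using width_pos by (intro assms(3)) simp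
  then show "p a = q a"
    using profile_mod[OF assms(1), of a] profile_mod[OF assms(2), of a] by simp
qed

text \<open>The difference \<open>w a - a\<close> is weakly increasing and agrees at 0 and at
  \<open>width\<close>, so it is constant on the window; the sum condition makes the constant
  0.\<close>

lemma equivariant_increasing_fixes:
  fixes w :: "int \<Rightarrow> int"
  assumes less: "\<And>a. w a < w (a + 1)" and shift: "w width = w 0 + width"
    and sum: "(\<Sum>a=0..<width. w a) = (\<Sum>a=0..<width. a)"
    and a: "a \<in> {0..<width}"
  shows "w a = a"
proof -
  have mono: "w a - a \<le> w b - b" if "a \<le> b" for a b
    using that
  proof (induction rule: int_ge_induct)
    case (step i)
    then show ?case using less[of i] by simp
  qed simp
  have const: "w b - b = w 0" if "b \<in> {0..<width}" for b
    using mono[of 0 b] mono[of b width] that shift by simp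
  have "(\<Sum>b=0..<width. w b - b) = (\<Sum>b=0..<width. w 0)"
    by (rule sum.cong[OF refl const])
  then have "width * w 0 = 0"
    using width_pos by (simp add: sum_subtractf sum)
  then show ?thesis using const[OF a] width_pos by simp
qed

text \<open>The permutation \<open>\<pi>\<close> and the translation part \<open>d\<close> together form an affine permutation
  \<open>w\<close> with \<open>p \<circ> w = q\<close>, which must be increasing.\<close>

lemma profile_permutation_trivial:
  assumes p: "profile p" and q: "profile q"
    and \<pi>: "\<pi> permutes {0..<width}"
    and d: "\<And>b. b \<in> {0..<width} \<Longrightarrow> p (\<pi> b) = q b + int n * d b"
    and sum: "(\<Sum>b=0..<width. d b) = 0"
  shows "\<pi> = id \<and> p = q"
proof -
  define w where "w a = \<pi> (a mod width) + (d (a mod width) + a div width) * width" for a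
  have pw: "p (w a) = q a" for a
  proof -
    have "a mod width \<in> {0..<width}" using width_pos by simp
    then show ?thesis
      unfolding w_def profile_shift[OF p] profile_mod[OF q, of a] d[OF \<open>a mod width \<in> _\<close>]
      by (simp add: algebra_simps)
  qed
  have w: "w b = \<pi> b + d b * width" if "b \<in> {0..<width}" for b
    using that by (simp add: w_def)
  \<comment> \<open>\<open>p\<close> reverses the order strictly, and
    \<open>p (w (a + 1)) = q (a + 1) < q a = p (w a)\<close>.\<close>
  have "w a < w (a + 1)" for a
    using profile_less[OF q, of a] by (simp add: profile_less_iff[OF p] flip: pw)
  moreover have "w width = w 0 + width"
    using width_pos by (simp add: w_def algebra_simps)
  moreover have "(\<Sum>b=0..<width. w b) = (\<Sum>b=0..<width. b)"
  proof -
    have "(\<Sum>b=0..<width. w b) = (\<Sum>b=0..<width. \<pi> b) + (\<Sum>b=0..<width. d b) * width"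
      by (simp add: w sum.distrib sum_distrib_right)
    then show ?thesis using sum sum.permute[OF \<pi>, of "\<lambda>b. b"] by (simp add: o_def)
  qed
  ultimately have fixed: "w b = b" if "b \<in> {0..<width}" for b
    using that by (rule equivariant_increasing_fixes)
  \<comment> \<open>Both \<open>\<pi> b\<close> and \<open>b\<close> lie in the window, so it
    suffices to compare them modulo \<open>width\<close>.\<close>
  have "\<pi> b = b" if b: "b \<in> {0..<width}" for b
  proof -
    have "\<pi> b \<in> {0..<width}" using b permutes_in_image[OF \<pi>] by blast
    moreover have "(\<pi> b + d b * width) mod width = b mod width"
      using fixed[OF b] w[OF b] by simp
    ultimately show ?thesis using b by simp
  qed
  then have "\<pi> = id" using permutes_not_in[OF \<pi>] by fastforce
  moreover have "p = q"
    using p q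
  proof (rule profile_eqI)
    fix a assume "a \<in> {0..<width}"
    then show "p a = q a" using pw[of a] fixed by simp
  qed
  ultimately show ?thesis ..
qed

text \<open>Every entry is a power of t or 0, so the term of \<open>\<pi>\<close> contributes to the
  constant coefficient only if all congruences hold and the exponents add up to 0. Such a
  \<open>\<pi>\<close> must be the identity, by \<open>profile_permutation_trivial\<close>.\<close>

lemma jacobi_trudi_0_vars:
  assumes p: "profile p" and q: "profile q"
  shows "jacobi_trudi n 0 r {0..<width} p q = (if p = q then 1 else 0)"
proof -
  let ?I = "{0..<width}"
  let ?k = "\<lambda>\<pi> b. (p (\<pi> b) - q b) div int n"
  let ?P = "\<lambda>\<pi>. (\<forall>b\<in>?I. int n dvd p (\<pi> b) - q b) \<and> (\<Sum>b\<in>?I. ?k \<pi> b) = 0"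
  have prod: "(\<Prod>b\<in>J. loop_entry n 0 r (p (\<pi> b)) (q b)) =
      (if \<forall>b\<in>J. int n dvd p (\<pi> b) - q b then Poly_Mapping.single (\<Sum>b\<in>J. ?k \<pi> b) 1 else 0)"
    if "finite J" for \<pi> J
    using that by (induction J) (auto simp: loop_entry_0_vars[OF n_pos] mult_single)
  have coeff: "Poly_Mapping.lookup (of_int (sign \<pi>) *
      (\<Prod>b\<in>?I. loop_entry n 0 r (p (\<pi> b)) (q b))) 0 = of_int (sign \<pi>) * of_bool (?P \<pi>)" for \<pi>
    unfolding prod[OF finite_atLeastLessThan_int]
    by (cases \<pi> rule: sign_cases) (auto simp: lookup_single when_def)
  have P: "?P \<pi> \<longleftrightarrow> \<pi> = id \<and> p = q" if \<pi>: "\<pi> permutes ?I" for \<pi>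
  proof
    assume P: "?P \<pi>"
    have "p (\<pi> b) = q b + int n * ?k \<pi> b" if "b \<in> ?I" for b
      using P that by simp
    then show "\<pi> = id \<and> p = q"
      using P by (intro profile_permutation_trivial[OF p q \<pi>]) auto
  qed simp
  have "jacobi_trudi n 0 r ?I p q =
      (\<Sum>\<pi> | \<pi> permutes ?I. of_int (sign \<pi>) * of_bool (?P \<pi>))"
    unfolding jacobi_trudi_def leibniz_sum_def lookup_sum coeff ..
  also have "\<dots> = (\<Sum>\<pi> | \<pi> permutes ?I. if \<pi> = id then of_bool (p = q) else 0)"
    by (intro sum.cong refl) (use P in auto)
  also have "\<dots> = of_bool (p = q)"
    by (simp add: finite_permutations permutes_id)
  finally show ?thesis by simp
qed

section \<open>Regions between two profiles\<close>

text \<open>\<open>box a c\<close> is the box of content \<open>c\<close> in column \<open>a\<close>.\<close>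

definition box :: "int \<Rightarrow> int \<Rightarrow> (int \<times> int) set" where
  "box a c = cyl_box n s a (- a - c)"

lemma cyl_box_eq_box: "cyl_box n s a b = box a (- a - b)"
  by (simp add: box_def)

lemma box_in_cyl: "box a c \<in> cyl n s"
  by (simp add: box_def cyl_box_def cyl_def quotientI)

lemma in_cyl_iff: "x \<in> cyl n s \<longleftrightarrow> (\<exists>a c. x = box a c)"
proof
  assume "x \<in> cyl n s"
  then obtain a b where "x = cyl_box n s a b"
    by (auto simp: cyl_def quotient_def cyl_box_def)
  then show "\<exists>a c. x = box a c" unfolding cyl_box_eq_box by blast
qed (auto simp: box_in_cyl)

lemma box_eq_iff: "box a c = box a' c' \<longleftrightarrow> (\<exists>k. a' = a + k * width \<and> c' = c - k * int n)"
proof -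
  have "box a c = box a' c' \<longleftrightarrow> ((a, - a - c), (a', - a' - c')) \<in> cyl_rel n s"
    unfolding box_def cyl_box_def using eq_equiv_class_iff[OF equiv_cyl_rel] by simp
  also have "\<dots> \<longleftrightarrow> (\<exists>k. a' = a + k * width \<and> c' = c - k * int n)"
    unfolding cyl_rel_def width_def by (auto simp: algebra_simps)
  finally show ?thesis .
qed

lemma box_shift: "box (a + k * width) (c - k * int n) = box a c"
  using box_eq_iff by metis

lemma box_mod: "box a c = box (a mod width) (c + (a div width) * int n)"
  using box_shift[of "a mod width" "a div width" "c + (a div width) * int n"]
  unfolding mod_div_mult_eq by simp

lemma box_inj: "box a c = box a c' \<Longrightarrow> c = c'"
  using width_pos by (auto simp: box_eq_iff)

lemma box_inj_column:
  assumes "box a c = box a' c'" "a \<in> {0..<width}" "a' \<in> {0..<width}"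
  shows "a = a'"
proof -
  obtain k where "a' = a + k * width" using assms(1) box_eq_iff by blast
  then have "a' mod width = a mod width" by simp
  then show ?thesis using assms(2,3) by simp
qed

lemma cyl_content_box': "cyl_content n (box a c) = c mod int n"
  unfolding box_def cyl_content_box by simp

definition region :: "(int \<Rightarrow> int) \<Rightarrow> (int \<Rightarrow> int) \<Rightarrow> (int \<times> int) set set" where
  "region p q = {box a c | a c. p a \<le> c \<and> c < q a}"

text \<open>Both profiles drop by \<open>n\<close> over one period, exactly as contents do, so the
  inequalities do not depend on the representative of the box.\<close>

lemma box_in_region_iff:
  assumes p: "profile p" and q: "profile q"
  shows "box a c \<in> region p q \<longleftrightarrow> p a \<le> c \<and> c < q a"
proof
  assume "box a c \<in> region p q"
  then obtain a' c' where *: "box a c = box a' c'" "p a' \<le> c'" "c' < q a'"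
    by (auto simp: region_def)
  then obtain k where "a' = a + k * width" "c' = c - k * int n"
    using box_eq_iff by blast
  with * show "p a \<le> c \<and> c < q a"
    by (simp add: profile_shift[OF p] profile_shift[OF q])
qed (auto simp: region_def)

lemma in_region_cases:
  assumes "x \<in> region p q"
  obtains a c where "x = box a c" "p a \<le> c" "c < q a"
  using assms by (auto simp: region_def)

text \<open>Every box has a representative in one of the \<open>width\<close> columns of the window,
  and each column is a finite interval of contents.\<close>

lemma finite_region:
  assumes p: "profile p" and q: "profile q"
  shows "finite (region p q)"
proof (rule finite_subset)
  show "region p q \<subseteq> (\<lambda>(a, c). box a c) ` (SIGMA a:{0..<width}. {p a..<q a})"
  proof
    fix x assume x: "x \<in> region p q"
    then obtain a c where "x = box a c" by (rule in_region_cases)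
    then have x': "x = box (a mod width) (c + (a div width) * int n)" by (simp add: box_mod[of a c])
    then have "a mod width \<in> {0..<width}"
      "c + (a div width) * int n \<in> {p (a mod width)..<q (a mod width)}"
      using x width_pos by (simp_all add: box_in_region_iff[OF p q])
    then show "x \<in> (\<lambda>(a, c). box a c) ` (SIGMA a:{0..<width}. {p a..<q a})"
      unfolding x' by (intro image_eqI[of _ _ "(a mod width, c + (a div width) * int n)"]) auto
  qed
qed simp

lemma region_eq_empty_iff:
  assumes p: "profile p" and q: "profile q" and "p \<le> q"
  shows "region p q = {} \<longleftrightarrow> p = q"
proof
  assume empty: "region p q = {}"
  show "p = q"
  proof
    fix a
    have "\<not> p a < q a"
      using empty box_in_region_iff[OF p q, of a "p a"] by simp
    then show "p a = q a" using le_funD[OF \<open>p \<le> q\<close>, of a] by simp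
  qed
qed (auto simp: region_def)


section \<open>Removing the largest entries of a tableau\<close>

text \<open>Columns congruent modulo \<open>width\<close> are lowered together, which preserves
  periodicity.\<close>

definition lower :: "int set \<Rightarrow> (int \<Rightarrow> int) \<Rightarrow> int \<Rightarrow> int" where
  "lower S q a = q a - of_bool (a mod width \<in> S)"

lemma lower_le: "lower S q a \<le> q a"
  by (simp add: lower_def)

lemma lower_shift: "profile q \<Longrightarrow> lower S q (a + width) = lower S q a - int n"
  by (simp add: lower_def profile_def)

text \<open>Translates to column and content coordinates: a step to the right lowers the content by
  1, a step down raises it by 1.\<close>

lemma ssyt_iff:
  "T \<in> cyl_ssyt n s m D \<longleftrightarrow> T \<in> D \<rightarrow>\<^sub>E {1..m} \<and>
    (\<forall>a c. box a c \<in> D \<and> box (a + 1) (c - 1) \<in> D \<longrightarrow> T (box a c) \<le> T (box (a + 1) (c - 1))) \<and>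
    (\<forall>a c. box a c \<in> D \<and> box a (c + 1) \<in> D \<longrightarrow> T (box a c) < T (box a (c + 1)))"
    (is "_ \<longleftrightarrow> _ \<and> ?row \<and> ?col")
proof -
  have 1: "box (a + 1) (- a - b - 1) = cyl_box n s (a + 1) b"
    "box a (- a - b + 1) = cyl_box n s a (b - 1)" for a b
    by (simp_all add: box_def)
  have 2: "cyl_box n s (a + 1) (- a - c) = box (a + 1) (c - 1)"
    "cyl_box n s a (- a - c - 1) = box a (c + 1)" for a c
    by (simp_all add: box_def algebra_simps)
  have "?row \<longleftrightarrow> (\<forall>a b. cyl_box n s a b \<in> D \<and> cyl_box n s (a + 1) b \<in> D \<longrightarrow>
      T (cyl_box n s a b) \<le> T (cyl_box n s (a + 1) b))"
    using 1 2 by (metis box_def cyl_box_eq_box)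
  moreover have "?col \<longleftrightarrow> (\<forall>a b. cyl_box n s a b \<in> D \<and> cyl_box n s a (b - 1) \<in> D \<longrightarrow>
      T (cyl_box n s a b) < T (cyl_box n s a (b - 1)))"
    using 1 2 by (metis box_def cyl_box_eq_box)
  ultimately show ?thesis by (simp add: cyl_ssyt_def)
qed

lemma ssyt_row:
  "T \<in> cyl_ssyt n s m D \<Longrightarrow> box a c \<in> D \<Longrightarrow> box (a + 1) (c - 1) \<in> D \<Longrightarrow>
    T (box a c) \<le> T (box (a + 1) (c - 1))"
  by (simp add: ssyt_iff)

lemma ssyt_col:
  "T \<in> cyl_ssyt n s m D \<Longrightarrow> box a c \<in> D \<Longrightarrow> box a (c + 1) \<in> D \<Longrightarrow> T (box a c) < T (box a (c + 1))"
  by (simp add: ssyt_iff)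

lemma ssyt_range: "T \<in> cyl_ssyt n s m D \<Longrightarrow> x \<in> D \<Longrightarrow> 1 \<le> T x \<and> T x \<le> m"
  by (auto simp: ssyt_iff)

lemma ssyt_extensional: "T \<in> cyl_ssyt n s m D \<Longrightarrow> x \<notin> D \<Longrightarrow> T x = undefined"
  unfolding ssyt_iff by (auto simp: PiE_def extensional_def)

lemma cyl_loop_schur_0_vars:
  "cyl_loop_schur n s 0 r D = (if D = {} then 1 else 0)"
proof (cases "D = {}")
  case False
  then have "cyl_ssyt n s 0 D = {}" by (auto simp: ssyt_iff)
  then show ?thesis using False by (simp add: cyl_loop_schur_def)
qed (simp add: cyl_loop_schur_empty)

text \<open>Columns of a tableau increase strictly, so when \<open>m\<close> is the largest
  admissible entry it occurs only in bottom boxes, and this set records all its positions.\<close>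

definition top_columns :: "nat \<Rightarrow> (int \<Rightarrow> int) \<Rightarrow> (int \<Rightarrow> int) \<Rightarrow> ((int \<times> int) set \<Rightarrow> nat) \<Rightarrow> int set" where
  "top_columns m p q T = {a \<in> {0..<width}. p a < q a \<and> T (box a (q a - 1)) = m}"

lemma mod_width_in_top_columns_iff:
  assumes p: "profile p" and q: "profile q"
  shows "a mod width \<in> top_columns m p q T \<longleftrightarrow> p a < q a \<and> T (box a (q a - 1)) = m"
proof -
  have "box (a mod width) (q (a mod width) - 1) = box a (q a - 1)"
    using box_shift[of "a mod width" "a div width" "q (a mod width) - 1"]
    unfolding mod_div_mult_eq profile_mod[OF q, of a] by (simp add: algebra_simps)
  then show ?thesis
    using width_pos by (simp add: top_columns_def profile_mod[OF p, of a] profile_mod[OF q, of a])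
qed

text \<open>Strictness could fail only if the bottom boxes of columns \<open>a\<close> and
  \<open>a + 1\<close> are neighbours in a row and just the left one is removed. But the row
  condition forces the entry \<open>m\<close> to the right of an entry \<open>m\<close>.\<close>

lemma lower_top_columns:
  assumes p: "profile p" and q: "profile q" and pq: "p \<le> q"
    and T: "T \<in> cyl_ssyt n s m (region p q)"
  defines "S \<equiv> top_columns m p q T"
  shows "profile (lower S q)" "p \<le> lower S q"
proof -
  have S: "a mod width \<in> S \<longleftrightarrow> p a < q a \<and> T (box a (q a - 1)) = m" for a
    unfolding S_def by (rule mod_width_in_top_columns_iff[OF p q])
  have "lower S q (a + 1) < lower S q a" for a
  proof (rule ccontr)
    assume "\<not> lower S q (a + 1) < lower S q a"
    then have eq: "q (a + 1) = q a - 1" and a: "a mod width \<in> S" and a1: "(a + 1) mod width \<notin> S"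
      using profile_less[OF q, of a] by (auto simp: lower_def of_bool_def split: if_splits)
    have a': "p a < q a" "T (box a (q a - 1)) = m" using a S by auto
    have pa1: "p (a + 1) < q (a + 1)" using a' profile_less[OF p, of a] eq by simp
    have in1: "box a (q a - 1) \<in> region p q" "box (a + 1) (q a - 1 - 1) \<in> region p q"
      using a' pa1 eq by (simp_all add: box_in_region_iff[OF p q])
    have "m \<le> T (box (a + 1) (q (a + 1) - 1))"
      using ssyt_row[OF T in1] a' eq by simp
    moreover have "T (box (a + 1) (q (a + 1) - 1)) \<le> m"
      using ssyt_range[OF T in1(2)] eq by simp
    ultimately show False using a1 S[of "a + 1"] pa1 by simp
  qed
  then show "profile (lower S q)"
    using lower_shift[OF q, of S] unfolding profile_def by simp
  show "p \<le> lower S q"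
  proof (rule le_funI)
    fix a
    show "p a \<le> lower S q a"
      using S[of a] le_funD[OF pq, of a] by (auto simp: lower_def of_bool_def)
  qed
qed

section \<open>Tableaux with prescribed positions of the largest entry\<close>

context
  fixes m :: nat and p q :: "int \<Rightarrow> int" and S :: "int set"
  assumes p: "profile p" and q: "profile q" and S: "S \<subseteq> {0..<width}"
    and q': "profile (lower S q)" and pq': "p \<le> lower S q"
begin

lemma region_lower_subset: "region p (lower S q) \<subseteq> region p q"
  using lower_le[of S q] unfolding region_def by (fastforce intro: less_le_trans)

text \<open>By \<open>p \<le> lower S q\<close> a lowered column is nonempty, so the box it loses
  really belongs to the larger region.\<close>

lemma box_in_region_diff_iff:
  "box a c \<in> region p q - region p (lower S q) \<longleftrightarrow> a mod width \<in> S \<and> c = q a - 1"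
  using le_funD[OF pq', of a]
  by (auto simp: box_in_region_iff[OF p q] box_in_region_iff[OF p q'] lower_def of_bool_def
      split: if_splits)

lemma region_diff_eq: "region p q - region p (lower S q) = (\<lambda>a. box a (q a - 1)) ` S"
proof (intro equalityI subsetI)
  fix x assume x: "x \<in> region p q - region p (lower S q)"
  then obtain a c where "x = box a c" by (auto elim: in_region_cases)
  then have xb: "x = box (a mod width) (c + (a div width) * int n)" by (simp add: box_mod[of a c])
  then show "x \<in> (\<lambda>a. box a (q a - 1)) ` S"
    using x box_in_region_diff_iff by auto
next
  fix x assume "x \<in> (\<lambda>a. box a (q a - 1)) ` S"
  then obtain a where "a \<in> S" and "x = box a (q a - 1)" by blast
  moreover from \<open>a \<in> S\<close> have "a mod width = a" using S by auto
  ultimately show "x \<in> region p q - region p (lower S q)"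
    using box_in_region_diff_iff by metis
qed

text \<open>Strictness leaves no box below an entry \<open>Suc m\<close>; hence that box is the
  bottom of a column in \<open>S\<close>, up to the shift, and has been removed.\<close>

lemma ssyt_restrict:
  assumes T: "T \<in> cyl_ssyt n s (Suc m) (region p q)" and top: "top_columns (Suc m) p q T = S"
  shows "restrict T (region p (lower S q)) \<in> cyl_ssyt n s m (region p (lower S q))"
proof -
  have le: "1 \<le> T x \<and> T x \<le> m" if x: "x \<in> region p (lower S q)" for x
  proof -
    obtain a c where xac: "x = box a c" and c: "p a \<le> c" "c < lower S q a"
      using x by (rule in_region_cases)
    have in_D: "x \<in> region p q" using x region_lower_subset by blast
    have "T x \<noteq> Suc m"
    proof
      assume eq: "T x = Suc m"
      have "box a (c + 1) \<notin> region p q"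
        using ssyt_col[OF T, of a c] ssyt_range[OF T, of "box a (c + 1)"] in_D eq xac by fastforce
      then have "c = q a - 1"
        using c lower_le[of S q a] by (auto simp: box_in_region_iff[OF p q])
      then have "a mod width \<in> S"
        using eq c lower_le[of S q a] mod_width_in_top_columns_iff[OF p q, of a "Suc m" T]
        by (simp add: top xac)
      then show False using c \<open>c = q a - 1\<close> by (simp add: lower_def)
    qed
    then show ?thesis using ssyt_range[OF T in_D] by simp
  qed
  then show ?thesis
    using region_lower_subset ssyt_row[OF T] ssyt_col[OF T] unfolding ssyt_iff
    by (auto simp: subset_iff)
qed

text \<open>Rows stay weakly increasing because the lowered boundary is a profile: the left
  neighbour of a kept box is kept. The value \<open>undefined\<close> outside the region keeps
  \<open>T'\<close> extensional.\<close>

lemma ssyt_extend: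
  assumes T: "T \<in> cyl_ssyt n s m (region p (lower S q))"
  defines "T' \<equiv> \<lambda>x. if x \<in> region p (lower S q) then T x
    else if x \<in> region p q then Suc m else undefined"
  shows "T' \<in> cyl_ssyt n s (Suc m) (region p q)" "top_columns (Suc m) p q T' = S"
proof -
  let ?D = "region p q" and ?D' = "region p (lower S q)"
  have in_D': "T' x = T x" "1 \<le> T' x" "T' x \<le> m" if "x \<in> ?D'" for x
    using that ssyt_range[OF T that] by (simp_all add: T'_def)
  have not_in_D': "T' x = Suc m" if "x \<in> ?D" "x \<notin> ?D'" for x
    using that by (simp add: T'_def)
  have range: "1 \<le> T' x \<and> T' x \<le> Suc m" if "x \<in> ?D" for x
    using that in_D'[of x] not_in_D'[of x] by (cases "x \<in> ?D'") auto
  have row: "T' (box a c) \<le> T' (box (a + 1) (c - 1))"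
    if D: "box a c \<in> ?D" "box (a + 1) (c - 1) \<in> ?D" for a c
  proof (cases "box (a + 1) (c - 1) \<in> ?D'")
    case True
    then have "box a c \<in> ?D'"
      using D profile_less[OF q', of a]
      by (simp add: box_in_region_iff[OF p q] box_in_region_iff[OF p q'])
    then show ?thesis using True ssyt_row[OF T] in_D' by simp
  next
    case False
    then show ?thesis using D range not_in_D' by simp
  qed
  have col: "T' (box a c) < T' (box a (c + 1))"
    if D: "box a c \<in> ?D" "box a (c + 1) \<in> ?D" for a c
  proof -
    \<comment> \<open>A column loses at most one box, so a box with another one below it is
      kept.\<close>
    have c: "box a c \<in> ?D'"
      using D by (auto simp: box_in_region_iff[OF p q] box_in_region_iff[OF p q'] lower_def of_bool_def)
    show ?thesis
    proof (cases "box a (c + 1) \<in> ?D'")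
      case True
      then show ?thesis using c ssyt_col[OF T] in_D' by simp
    next
      case False
      then show ?thesis using D c in_D'(3)[of "box a c"] not_in_D'[of "box a (c + 1)"] by simp
    qed
  qed
  show "T' \<in> cyl_ssyt n s (Suc m) ?D"
    unfolding ssyt_iff
  proof (intro conjI)
    show "T' \<in> ?D \<rightarrow>\<^sub>E {1..Suc m}"
      using range region_lower_subset by (auto simp: T'_def)
  qed (use row col in blast)+
  have "p a < q a \<and> T' (box a (q a - 1)) = Suc m \<longleftrightarrow> a \<in> S" if a: "a \<in> {0..<width}" for a
  proof -
    have "p a < q a \<and> T' (box a (q a - 1)) = Suc m \<longleftrightarrow> box a (q a - 1) \<in> ?D - ?D'"
    proof
      assume *: "p a < q a \<and> T' (box a (q a - 1)) = Suc m"
      then have "box a (q a - 1) \<notin> ?D'" using in_D'(3)[of "box a (q a - 1)"] by auto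
      then show "box a (q a - 1) \<in> ?D - ?D'" using * by (simp add: box_in_region_iff[OF p q])
    next
      assume *: "box a (q a - 1) \<in> ?D - ?D'"
      then show "p a < q a \<and> T' (box a (q a - 1)) = Suc m"
        using not_in_D' by (simp add: box_in_region_iff[OF p q])
    qed
    then show ?thesis using a box_in_region_diff_iff by simp
  qed
  then have "top_columns (Suc m) p q T' = {a \<in> {0..<width}. a \<in> S}"
    unfolding top_columns_def by blast
  then show "top_columns (Suc m) p q T' = S" using S by auto
qed

text \<open>Restriction to the smaller region and filling with \<open>Suc m\<close> are inverse
  bijections. The weights differ by the variables of the removed boxes, whose contents are
  \<open>q b - 1\<close> modulo \<open>n\<close>.\<close>

lemma sum_ssyt_top_columns:
  "(\<Sum>T | T \<in> cyl_ssyt n s (Suc m) (region p q) \<and> top_columns (Suc m) p q T = S.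
      \<Prod>d\<in>region p q. loop_var n (T d) (cyl_content n d + r)) =
    (\<Prod>b\<in>S. loop_var n (Suc m) (q b - 1 + r)) * cyl_loop_schur n s m r (region p (lower S q))"
proof -
  let ?D = "region p q" and ?D' = "region p (lower S q)"
  let ?w = "\<lambda>T d. loop_var n (T d) (cyl_content n d + r)"
  have top: "(\<Prod>d\<in>?D - ?D'. ?w T d) = (\<Prod>b\<in>S. loop_var n (Suc m) (q b - 1 + r))"
    if T: "T \<in> cyl_ssyt n s (Suc m) ?D" "top_columns (Suc m) p q T = S" for T
  proof -
    \<comment> \<open>\<open>S\<close> lies in one window, where boxes of different columns are
      different.\<close>
    have "inj_on (\<lambda>a. box a (q a - 1)) S"
      using S by (intro inj_onI) (blast intro: box_inj_column)
    then have "(\<Prod>d\<in>?D - ?D'. ?w T d) = (\<Prod>b\<in>S. ?w T (box b (q b - 1)))"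
      unfolding region_diff_eq by (simp add: prod.reindex)
    also have "\<dots> = (\<Prod>b\<in>S. loop_var n (Suc m) (q b - 1 + r))"
    proof (rule prod.cong[OF refl])
      fix b assume "b \<in> S"
      then have "T (box b (q b - 1)) = Suc m" using T(2) by (auto simp: top_columns_def)
      then show "?w T (box b (q b - 1)) = loop_var n (Suc m) (q b - 1 + r)"
        by (simp add: cyl_content_box' mod_add_left_eq loop_var_def)
    qed
    finally show ?thesis .
  qed
  have "(\<Sum>T | T \<in> cyl_ssyt n s (Suc m) ?D \<and> top_columns (Suc m) p q T = S. \<Prod>d\<in>?D. ?w T d) =
      (\<Sum>T\<in>cyl_ssyt n s m ?D'. (\<Prod>b\<in>S. loop_var n (Suc m) (q b - 1 + r)) * (\<Prod>d\<in>?D'. ?w T d))"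
  proof (rule sum.reindex_bij_witness[where
        i = "\<lambda>T x. if x \<in> ?D' then T x else if x \<in> ?D then Suc m else undefined" and
        j = "\<lambda>T. restrict T ?D'"], goal_cases)
    case (1 T)
    then have T: "T \<in> cyl_ssyt n s (Suc m) ?D" "top_columns (Suc m) p q T = S" by auto
    have "T x = Suc m" if "x \<in> ?D - ?D'" for x
      using that T(2) unfolding region_diff_eq by (auto simp: top_columns_def)
    then show ?case
      using ssyt_extensional[OF T(1)] region_lower_subset by (auto simp: fun_eq_iff)
  next
    case (2 T)
    then show ?case using ssyt_restrict by simp
  next
    case (3 T)
    then show ?case using ssyt_extensional[OF 3] by (auto simp: fun_eq_iff)
  next
    case (4 T)
    then show ?case using ssyt_extend by simp
  next
    case (5 T)
    then have "(\<Prod>d\<in>?D. ?w T d) =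
        (\<Prod>b\<in>S. loop_var n (Suc m) (q b - 1 + r)) * (\<Prod>d\<in>?D'. ?w T d)"
      unfolding prod.subset_diff[OF region_lower_subset finite_region[OF p q]]
      by (simp add: top)
    also have "(\<Prod>d\<in>?D'. ?w T d) = (\<Prod>d\<in>?D'. ?w (restrict T ?D') d)"
      by (intro prod.cong refl) simp
    finally show ?case ..
  qed
  then show ?thesis by (simp only: cyl_loop_schur_def sum_distrib_left)
qed

end

text \<open>Tableaux are grouped by the positions of the largest entry;
  \<open>lower_top_columns\<close> ensures that only the sets \<open>S\<close> listed here
  occur.\<close>

lemma cyl_loop_schur_Suc:
  assumes p: "profile p" and q: "profile q" and pq: "p \<le> q"
  shows "cyl_loop_schur n s (Suc m) r (region p q) =
    (\<Sum>S | S \<subseteq> {0..<width} \<and> profile (lower S q) \<and> p \<le> lower S q.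
      (\<Prod>b\<in>S. loop_var n (Suc m) (q b - 1 + r)) * cyl_loop_schur n s m r (region p (lower S q)))"
proof -
  let ?good = "{S. S \<subseteq> {0..<width} \<and> profile (lower S q) \<and> p \<le> lower S q}"
  let ?T = "cyl_ssyt n s (Suc m) (region p q)"
  let ?w = "\<lambda>T. \<Prod>d\<in>region p q. loop_var n (T d) (cyl_content n d + r)"
  have "finite ?good" by (rule finite_subset[of _ "Pow {0..<width}"]) auto
  moreover have "finite ?T" by (intro finite_cyl_ssyt finite_region p q)
  moreover have "top_columns (Suc m) p q ` ?T \<subseteq> ?good"
    using lower_top_columns[OF p q pq] by (auto simp: top_columns_def)
  ultimately have "cyl_loop_schur n s (Suc m) r (region p q) =
      (\<Sum>S\<in>?good. \<Sum>T | T \<in> ?T \<and> top_columns (Suc m) p q T = S. ?w T)"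
    unfolding cyl_loop_schur_def by (intro sum.group[symmetric])
  also have "\<dots> = (\<Sum>S\<in>?good. (\<Prod>b\<in>S. loop_var n (Suc m) (q b - 1 + r)) *
      cyl_loop_schur n s m r (region p (lower S q)))"
    by (intro sum.cong refl sum_ssyt_top_columns) (use p q in auto)
  finally show ?thesis .
qed

text \<open>When lowering breaks strict monotonicity, two adjacent columns collide modulo \<open>n\<close>.\<close>

lemma jacobi_trudi_lower_eq_0:
  assumes q: "profile q" and not: "\<not> profile (lower S q)" and n: "2 \<le> n"
  shows "jacobi_trudi n m r {0..<width} p (lower S q) = 0"
proof -
  let ?q = "lower S q"
  obtain a where a: "\<not> ?q (a + 1) < ?q a"
    using not lower_shift[OF q, of S] unfolding profile_def by blast
  \<comment> \<open>Only a gap of exactly 1 can be closed, by lowering the left column and not the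
    right one; both new values are then \<open>q a - 1\<close>.\<close>
  then have eq: "q (a + 1) = q a - 1" and S: "a mod width \<in> S" "(a + 1) mod width \<notin> S"
    using profile_less[OF q, of a] by (auto simp: lower_def of_bool_def split: if_splits)
  have mod: "?q b = ?q (b mod width) - (b div width) * int n" for b
    using profile_mod[OF q, of b] by (simp add: lower_def)
  show ?thesis
  proof (rule jacobi_trudi_eq_0)
    \<comment> \<open>Exactly one of the two residues lies in \<open>S\<close>.\<close>
    show "a mod width \<noteq> (a + 1) mod width" using S by metis
    show "?q (a mod width) = ?q ((a + 1) mod width) + int n * (a div width - (a + 1) div width)"
      using mod[of a] mod[of "a + 1"] eq S by (simp add: lower_def algebra_simps)
  qed (use width_pos n_pos in auto)
qed

text \<open>Both sides satisfy the same recursion in \<open>m\<close>. The case where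
  \<open>p \<le> q\<close> fails is part of the claim because lowering \<open>q\<close> may take it
  below \<open>p\<close>.\<close>

theorem jacobi_trudi_eq_cyl_loop_schur:
  assumes p: "profile p" and "profile q" and n: "2 \<le> n"
  shows "jacobi_trudi n m r {0..<width} p q =
    (if p \<le> q then cyl_loop_schur n s m r (region p q) else 0)"
  using assms(2)
proof (induction m arbitrary: q)
  case 0
  then show ?case
    using region_eq_empty_iff[OF p] by (auto simp: jacobi_trudi_0_vars[OF p] cyl_loop_schur_0_vars)
next
  case (Suc m)
  let ?I = "{0..<width}"
  let ?u = "\<lambda>S. \<Prod>b\<in>S. loop_var n (Suc m) (q b - 1 + r)"
  let ?good = "\<lambda>S. profile (lower S q) \<and> p \<le> lower S q"
  have "jacobi_trudi n (Suc m) r ?I p q =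
      (\<Sum>S\<in>Pow ?I. ?u S * jacobi_trudi n m r ?I p (lower S q))"
    \<comment> \<open>Only columns of the window enter the determinant, and there
      \<open>b mod width = b\<close>, so lowering one column and lowering its whole class
      agree.\<close>
    unfolding jacobi_trudi_Suc[OF n_pos finite_atLeastLessThan_int]
    by (intro sum.cong refl arg_cong2[of _ _ _ _ "(*)"] jacobi_trudi_cong) (simp add: lower_def)
  also have "\<dots> = (\<Sum>S\<in>Pow ?I. if ?good S
      then ?u S * cyl_loop_schur n s m r (region p (lower S q)) else 0)"
  proof (rule sum.cong[OF refl])
    fix S
    show "?u S * jacobi_trudi n m r ?I p (lower S q) =
        (if ?good S then ?u S * cyl_loop_schur n s m r (region p (lower S q)) else 0)"
      by (cases "profile (lower S q)") (simp_all add: Suc.IH jacobi_trudi_lower_eq_0[OF Suc.prems _ n])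
  qed
  also have "\<dots> = (\<Sum>S | S \<in> Pow ?I \<and> ?good S.
      ?u S * cyl_loop_schur n s m r (region p (lower S q)))"
    by (rule sum.inter_filter[symmetric]) simp
  also have "\<dots> = (if p \<le> q then cyl_loop_schur n s (Suc m) r (region p q) else 0)"
  proof (cases "p \<le> q")
    case True
    then show ?thesis by (simp add: cyl_loop_schur_Suc[OF p Suc.prems])
  next
    case False
    then have "\<not> p \<le> lower S q" for S
      using lower_le[of S q] unfolding le_fun_def by (meson order_trans)
    then show ?thesis using False by simp
  qed
  finally show ?case .
qed


section \<open>Cylindric skew shapes as regions\<close>

lemma cyl_less_cover_row: "(box a c, box (a + 1) (c - 1)) \<in> cyl_less n s"
proof -
  have "box (a + 1) (c - 1) = cyl_box n s (a + 1) (- a - c)" by (simp add: box_def)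
  then show ?thesis unfolding cyl_less_def box_def[of a c] by (intro r_into_trancl) blast
qed

lemma cyl_less_cover_col: "(box a c, box a (c + 1)) \<in> cyl_less n s"
proof -
  have "box a (c + 1) = cyl_box n s a (- a - c - 1)" by (simp add: box_def algebra_simps)
  then show ?thesis unfolding cyl_less_def box_def[of a c] by (intro r_into_trancl) blast
qed

lemma cyl_less_trans: "(x, y) \<in> cyl_less n s \<Longrightarrow> (y, z) \<in> cyl_less n s \<Longrightarrow> (x, z) \<in> cyl_less n s"
  unfolding cyl_less_def by (rule trancl_trans)

lemma cyl_less_induct [consumes 1, case_names row col trans]:
  assumes "(x, y) \<in> cyl_less n s"
    and row: "\<And>a c. P (box a c) (box (a + 1) (c - 1))"
    and col: "\<And>a c. P (box a c) (box a (c + 1))"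
    and trans: "\<And>x y z. P x y \<Longrightarrow> P y z \<Longrightarrow> P x z"
  shows "P x y"
proof -
  have cover: "P x y"
    if xy: "(x, y) \<in> {(cyl_box n s a b, cyl_box n s (a + 1) b) | a b. True} \<union>
      {(cyl_box n s a b, cyl_box n s a (b - 1)) | a b. True}" for x y
  proof -
    obtain a b where "x = cyl_box n s a b"
      "y = cyl_box n s (a + 1) b \<or> y = cyl_box n s a (b - 1)"
      using xy by blast
    then show ?thesis
      using row[of a "- a - b"] col[of a "- a - b"] by (auto simp: box_def)
  qed
  show ?thesis
    using assms(1) unfolding cyl_less_def
  proof (induction rule: trancl_induct)
    case (base y)
    then show ?case by (rule cover)
  next
    case (step y z)
    then show ?case using cover trans by blast
  qed
qed

text \<open>\<open>n a + width c\<close> is invariant under the shift defining the cylinder, so the description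
  is satisfied.\<close>

definition height :: "(int \<times> int) set \<Rightarrow> int" where
  "height x = (THE h. \<forall>a c. x = box a c \<longrightarrow> h = int n * a + width * c)"

lemma height_box: "height (box a c) = int n * a + width * c"
  unfolding height_def
proof (rule the_equality)
  show "\<forall>a' c'. box a c = box a' c' \<longrightarrow> int n * a + width * c = int n * a' + width * c'"
    by (auto simp: box_eq_iff algebra_simps)
qed blast

text \<open>A row step raises the height by \<open>n - width = s\<close>, a column step by
  \<open>width\<close>. This bounds from below the heights in an upset generated by finitely many
  boxes.\<close>

lemma height_mono: "(x, y) \<in> cyl_less n s \<Longrightarrow> height x \<le> height y"
proof (induction rule: cyl_less_induct)
  case (row a c)
  show ?case by (simp add: height_box width_def algebra_simps)
next
  case (col a c)
  show ?case using width_pos by (simp add: height_box algebra_simps)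
qed simp

lemma least_int:
  fixes A :: "int set"
  assumes "A \<noteq> {}" "bdd_below A" "\<And>c. c \<in> A \<Longrightarrow> c + 1 \<in> A"
  obtains p where "\<And>c. c \<in> A \<longleftrightarrow> p \<le> c"
proof -
  obtain l where l: "\<And>c. c \<in> A \<Longrightarrow> l \<le> c" using assms(2) by (auto simp: bdd_below_def)
  define k where "k = (LEAST k. l + int k \<in> A)"
  obtain c0 where "c0 \<in> A" using assms(1) by blast
  then have "l + int (nat (c0 - l)) \<in> A" using l by simp
  then have kA: "l + int k \<in> A" unfolding k_def by (rule LeastI)
  show thesis
  proof (rule that[of "l + int k"], rule iffI)
    fix c assume c: "c \<in> A"
    then have "l + int (nat (c - l)) \<in> A" using l by simp
    then have "k \<le> nat (c - l)" unfolding k_def by (rule Least_le)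
    then show "l + int k \<le> c" using l[OF c] by simp
  next
    fix c assume "l + int k \<le> c"
    then show "c \<in> A"
      by (induction rule: int_ge_induct) (use kA assms(3) in auto)
  qed
qed

text \<open>Each column of an upset is a ray of contents: nonempty since the given box has
  translates arbitrarily far to the left, and bounded below by the height. Row steps make the
  starting points strictly decreasing.\<close>

lemma upset_profile:
  assumes ne: "box a0 c0 \<in> W"
    and bound: "\<And>a c. box a c \<in> W \<Longrightarrow> h \<le> int n * a + width * c"
    and row: "\<And>a c. box a c \<in> W \<Longrightarrow> box (a + 1) (c - 1) \<in> W"
    and col: "\<And>a c. box a c \<in> W \<Longrightarrow> box a (c + 1) \<in> W"
  obtains p where "profile p" "\<And>a c. box a c \<in> W \<longleftrightarrow> p a \<le> c"
proof -
  have ex: "\<exists>p. \<forall>c. box a c \<in> W \<longleftrightarrow> p \<le> c" for a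
  proof -
    \<comment> \<open>Since \<open>width\<close> is at least 1, moving the given box by this many
      periods places it in column \<open>a\<close> or to its left.\<close>
    define k where "k = - \<bar>a - a0\<bar>"
    have k: "a0 + k * width \<le> a"
    proof -
      have "\<bar>a - a0\<bar> * 1 \<le> \<bar>a - a0\<bar> * width" using width_pos by (intro mult_left_mono) auto
      then show ?thesis by (simp add: k_def)
    qed
    have start: "box (a0 + k * width) (c0 - k * int n) \<in> W"
      using ne by (simp only: box_shift)
    \<comment> \<open>Walking right from the translated box to column \<open>a\<close> costs 1 in
      content per step.\<close>
    have "box a (c0 - k * int n - (a - (a0 + k * width))) \<in> W"
      using k
    proof (induction rule: int_ge_induct)
      case base
      then show ?case using start by simp
    next
      case (step i)
      then show ?case using row by (metis add_diff_cancel_right' diff_diff_eq diff_add_eq)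
    qed
    then have "{c. box a c \<in> W} \<noteq> {}" by blast
    moreover have "bdd_below {c. box a c \<in> W}"
    proof (rule bdd_belowI)
      fix c assume "c \<in> {c. box a c \<in> W}"
      then have "h - int n * a \<le> width * c" using bound[of a c] by simp
      then show "- \<bar>h - int n * a\<bar> \<le> c"
      proof (cases "0 \<le> c")
        case False
        then have "width * c \<le> 1 * c" using width_pos by (intro mult_right_mono_neg) auto
        then show ?thesis using \<open>h - int n * a \<le> width * c\<close> by linarith
      qed auto
    qed
    ultimately obtain p where "\<And>c. c \<in> {c. box a c \<in> W} \<longleftrightarrow> p \<le> c"
      by (rule least_int) (use col in auto)
    then show ?thesis by auto
  qed
  then obtain p where p: "\<And>a c. box a c \<in> W \<longleftrightarrow> p a \<le> c" by metis
  have "p (a + 1) < p a" for a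
    using row[of a "p a"] p by fastforce
  moreover have "p (a + width) = p a - int n" for a
  proof -
    have "p (a + width) \<le> c \<longleftrightarrow> p a - int n \<le> c" for c
      using box_shift[of a 1 "c + int n"] p[of a "c + int n"] p[of "a + width" c] by auto
    then show ?thesis by (meson order_antisym order_refl)
  qed
  ultimately have "profile p" by (simp add: profile_def)
  then show thesis using p that by blast
qed

text \<open>The upset \<open>U\<close> generated by \<open>D\<close> and, by convexity, also
  \<open>U - D\<close> are upsets. Their profiles bound \<open>D\<close> from above and from
  below.\<close>

lemma cyl_shape_region:
  assumes D: "cyl_shape n s D" and ne: "D \<noteq> {}"
  obtains p q where "profile p" "profile q" "p \<le> q" "D = region p q"
proof -
  have sub: "D \<subseteq> cyl n s" and fin: "finite D"
    and conv: "\<And>x y z. x \<in> D \<Longrightarrow> z \<in> D \<Longrightarrow> y \<in> cyl n s \<Longrightarrow>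
      (x, y) \<in> cyl_less n s \<Longrightarrow> (y, z) \<in> cyl_less n s \<Longrightarrow> y \<in> D"
    using D unfolding cyl_shape_def by blast+
  define U where "U = {y \<in> cyl n s. \<exists>x\<in>D. x = y \<or> (x, y) \<in> cyl_less n s}"
  have DU: "D \<subseteq> U" using sub by (auto simp: U_def)
  have U_up: "z \<in> U" if "y \<in> U" "(y, z) \<in> cyl_less n s" "z \<in> cyl n s" for y z
    using that cyl_less_trans unfolding U_def by blast
  have V_up: "z \<in> U - D" if y: "y \<in> U - D" and yz: "(y, z) \<in> cyl_less n s" "z \<in> cyl n s" for y z
  proof -
    \<comment> \<open>Otherwise \<open>y\<close> would lie between an element of \<open>D\<close>
      and \<open>z\<close>, hence in \<open>D\<close>.\<close>
    have "z \<notin> D" using y yz conv unfolding U_def by blast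
    then show ?thesis using U_up y yz by blast
  qed
  have D_box: "\<exists>a c. x = box a c" if "x \<in> D" for x
    using subsetD[OF sub that] by (simp only: in_cyl_iff)
  obtain x0 where "x0 \<in> D" using ne by blast
  then obtain a0 c0 where start: "box a0 c0 \<in> D" using D_box by metis
  have bound: "Min (height ` D) \<le> int n * a + width * c" if ac: "box a c \<in> U" for a c
  proof -
    obtain x where x: "x \<in> D" "x = box a c \<or> (x, box a c) \<in> cyl_less n s"
      using ac by (auto simp: U_def)
    then have "height x \<le> height (box a c)" using height_mono by auto
    moreover have "Min (height ` D) \<le> height x" using x(1) fin by simp
    ultimately show ?thesis by (simp add: height_box)
  qed
  obtain p where p: "profile p" "\<And>a c. box a c \<in> U \<longleftrightarrow> p a \<le> c"
  proof (rule upset_profile)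
    show "box a0 c0 \<in> U" by (rule subsetD[OF DU start])
    show "Min (height ` D) \<le> int n * a + width * c" if "box a c \<in> U" for a c
      using that bound by blast
    show "box (a + 1) (c - 1) \<in> U" if "box a c \<in> U" for a c
      by (rule U_up[OF that cyl_less_cover_row box_in_cyl])
    show "box a (c + 1) \<in> U" if "box a c \<in> U" for a c
      by (rule U_up[OF that cyl_less_cover_col box_in_cyl])
  qed (rule that)
  have U_col: "box a0 (c0 + int k) \<in> U" for k
    using p(2) start DU by fastforce
  \<comment> \<open>The finite set \<open>D\<close> cannot contain the infinite column below the
    starting box, so \<open>U - D\<close> is nonempty and has a profile.\<close>
  have "infinite (range (\<lambda>k. box a0 (c0 + int k)))"
  proof -
    have "inj (\<lambda>k. box a0 (c0 + int k))" by (auto simp: inj_def dest: box_inj)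
    then show ?thesis using finite_imageD infinite_UNIV_nat by blast
  qed
  then obtain k where "box a0 (c0 + int k) \<notin> D"
    using fin finite_subset by (metis image_subsetI)
  then have startV: "box a0 (c0 + int k) \<in> U - D" using U_col by blast
  obtain q where q: "profile q" "\<And>a c. box a c \<in> U - D \<longleftrightarrow> q a \<le> c"
  proof (rule upset_profile)
    show "box a0 (c0 + int k) \<in> U - D" by (rule startV)
    show "Min (height ` D) \<le> int n * a + width * c" if "box a c \<in> U - D" for a c
      using that bound by blast
    show "box (a + 1) (c - 1) \<in> U - D" if "box a c \<in> U - D" for a c
      by (rule V_up[OF that cyl_less_cover_row box_in_cyl])
    show "box a (c + 1) \<in> U - D" if "box a c \<in> U - D" for a c
      by (rule V_up[OF that cyl_less_cover_col box_in_cyl])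
  qed (rule that)
  have box_D: "box a c \<in> D \<longleftrightarrow> p a \<le> c \<and> c < q a" for a c
    using p(2)[of a c] q(2)[of a c] DU by auto
  have "p \<le> q"
    using p(2) q(2) by (intro le_funI) blast
  moreover have "D = region p q"
    using box_D D_box unfolding region_def by fastforce
  ultimately show thesis using that p(1) q(1) by blast
qed

end

theorem theorem4p4:
  fixes n m s :: nat and r :: int and D :: "(int \<times> int) set set"
  assumes "2 \<le> n" and "1 \<le> m" and "1 \<le> s" and "s \<le> n - 1"
    and "cyl_shape n s D"
  shows "cyl_loop_schur n s m r D \<in> LSym n m"
proof (cases "D = {}")
  \<comment> \<open>The empty shape generates an empty upset, to which no profile belongs, so it is
    treated apart.\<close>
  case True
  then show ?thesis by (simp add: cyl_loop_schur_empty LSym_def subring_generated.one)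
next
  case False
  interpret cylinder n s using assms by unfold_locales auto
  obtain p q where pq: "profile p" "profile q" "p \<le> q" "D = region p q"
    using assms(5) False by (rule cyl_shape_region)
  have "cyl_loop_schur n s m r D = jacobi_trudi n m r {0..<width} p q"
    using jacobi_trudi_eq_cyl_loop_schur[OF pq(1,2) assms(1)] pq(3,4) by simp
  then show ?thesis using jacobi_trudi_in_LSym[OF n_pos] by simp
qed

end
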